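(* Consider the mixed constrained problem (MCP) of minimizing $f(x)$ over $x\in\mathcal{M}$ subject to $g_i(x)\le 0$ for $i\in\mathcal{I}$ and $h_j(x)=0$ for $j\in\mathcal{E}$. Run the Riemannian exact penalty method via smoothing (REPMS) described in the context, with either choice $Q\in\{Q^{\mathrm{lse}},Q^{\mathrm{lqh}}\}$, with $d_{\min}=u_{\min}=\epsilon_{\min}=0$ and $\mathrm{update}_\rho=\mathrm{False}$. If the sequence $\{x_k\}$ produced by the subsolver admits a feasible limit point $\overline{x}$ (i.e., some subsequence converges to a feasible $\overline{x}$) at which LICQ holds, then $\overline{x}$ satisfies the KKT conditions of the MCP.
   Context: Setting. $\mathcal{M}$ is a complete, smooth, finite-dimensional Riemannian manifold with metric $\langle\cdot,\cdot\rangle$, norm $\|\cdot\|$ and Riemannian distance $\mathrm{dist}$. $\mathcal{I}=\{1,\dots,n\}$, $\mathcal{E}=\{n+1,\dots,n+m\}$, and $f$, $g_i$ ($i\in\mathcal{I}$), $h_j$ ($j\in\mathcal{E}$) are twice continuously differentiable functions $\mathcal{M}\to\mathbb{R}$. A point $x\in\mathcal{M}$ is feasible if $g_i(x)\le0$ for all $i\in\mathcal{I}$ and $h_j(x)=0$ for all $j\in\mathcal{E}$. $\operatorname{grad}$ is the Riemannian gradient (with respect to $x$). Active set: $\mathcal{A}(x)=\mathcal{E}\cup\{i\in\mathcal{I}:g_i(x)=0\}$. LICQ at $x$: the family $\{\operatorname{grad}g_i(x)\}_{i\in\mathcal{A}(x)\cap\mathcal{I}}\cup\{\operatorname{grad}h_j(x)\}_{j\in\mathcal{E}}$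 is linearly independent in $\mathrm{T}_x\mathcal{M}$. KKT conditions at a feasible $x^*$: there exist $\lambda^*\in\mathbb{R}^n$, $\gamma^*\in\mathbb{R}^m$ (indexed by $\mathcal{I}$ and $\mathcal{E}$) with $\operatorname{grad}f(x^* )+\sum_{i\in\mathcal{I}}\lambda_i^*\operatorname{grad}g_i(x^* )+\sum_{j\in\mathcal{E}}\gamma_j^*\operatorname{grad}h_j(x^* )=0$; $h_j(x^* )=0$ for all $j\in\mathcal{E}$; and $g_i(x^* )\le0$, $\lambda_i^*\ge0$, $\lambda_i^*g_i(x^* )=0$ for all $i\in\mathcal{I}$. Smoothed penalty functions, for $\rho>0$, $u>0$: $$Q^{\mathrm{lse}}(x,\rho,u)=f(x)+\rho\sum_{i\in\mathcal{I}}u\log\big(1+e^{g_i(x)/u}\big)+\rho\sum_{j\in\mathcal{E}}u\log\big(e^{h_j(x)/u}+e^{-h_j(x)/u}\big),$$ $$Q^{\mathrm{lqh}}(x,\rho,u)=f(x)+\rho\sum_{i\in\mathcal{I}}\mathcal{P}(g_i(x),u)+\rho\sum_{j\in\mathcal{E}}\sqrt{h_j(x)^2+u^2},$$ where $\mathcal{P}(t,u)=0$ if $t\le0$, $\mathcal{P}(t,u)=\frac{t^2}{2u}$ if $0\le t\le u$, and $\mathcal{P}(t,u)=t-\frac{u}{2}$ if $t\ge u$. REPMS. Inputs: $x_0\in\mathcal{M}$; $\epsilon_{\min}\ge0$; $\epsilon_0>0$; $\rho_0>0$; $u_0>0$; $u_{\min}\ge0$; constants $\theta_\epsilon,\theta_u\in(0,1)$,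 $\theta_\rho>1$, $\tau\ge0$; a choice $Q\in\{Q^{\mathrm{lse}},Q^{\mathrm{lqh}}\}$; $d_{\min}\ge0$; a flag $\mathrm{update}_\rho\in\{\mathrm{True},\mathrm{False}\}$. For $k=0,1,2,\dots$: 1. A subsolver, warm-started at $x_k$, approximately solves $\min_{x\in\mathcal{M}}Q(x,\rho_k,u_k)$ and returns a point $x_{k+1}$ satisfying the stopping criterion $\|\operatorname{grad}Q(x_{k+1},\rho_k,u_k)\|\le\epsilon_k$. 2. If $\mathrm{dist}(x_k,x_{k+1})<d_{\min}$ and $\epsilon_k\le\epsilon_{\min}$ and $u_k\le u_{\min}$, return $x_{k+1}$. (This never happens if $d_{\min}=u_{\min}=\epsilon_{\min}=0$.) 3. $\epsilon_{k+1}=\max\{\epsilon_{\min},\theta_\epsilon\epsilon_k\}$, $u_{k+1}=\max\{u_{\min},\theta_uu_k\}$. 4. If $\mathrm{update}_\rho=\mathrm{True}$ and ($k=0$ or $\max_{j\in\mathcal{E},i\in\mathcal{I}}\{|h_j(x_{k+1})|,g_i(x_{k+1})\}\ge\tau$), set $\rho_{k+1}=\theta_\rho\rho_k$; otherwise $\rho_{k+1}=\rho_k$. (With $\mathrm{update}_\rho=\mathrm{False}$, $\rho_k=\rho_0$ for all $k$.) *)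

theory Defs
  imports "HOL-Analysis.Analysis" "HOL-Library.Function_Algebras"
begin

instantiation "fun" :: (type, real_vector) real_vector
begin

definition scaleR_fun :: "real \<Rightarrow> ('a \<Rightarrow> 'b) \<Rightarrow> 'a \<Rightarrow> 'b" where
  "scaleR_fun r f = (\<lambda>x. r *\<^sub>R f x)"

instance
  by standard (auto simp: scaleR_fun_def plus_fun_def fun_eq_iff algebra_simps)

end

text \<open>Used for open sets in finite-dimensional spaces only, where continuity of all iterated
  directional derivatives is the usual notion of class C^k.\<close>

primrec Ck_on :: "nat \<Rightarrow> ('e::real_normed_vector \<Rightarrow> 'f::real_normed_vector) \<Rightarrow> 'e set \<Rightarrow> bool" where
  "Ck_on 0 F S \<longleftrightarrow> continuous_on S F"
| "Ck_on (Suc k) F S \<longleftrightarrow>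
     F differentiable_on S \<and> (\<forall>v. Ck_on k (\<lambda>x. frechet_derivative F (at x) v) S)"

definition smooth_on :: "('e::real_normed_vector \<Rightarrow> 'f::real_normed_vector) \<Rightarrow> 'e set \<Rightarrow> bool" where
  "smooth_on F S \<longleftrightarrow> (\<forall>k. Ck_on k F S)"

text \<open>A chart is its domain together with its coordinate map.\<close>

type_synonym ('a, 'e) chart = "'a set \<times> ('a \<Rightarrow> 'e)"

definition chart_inv :: "('a, 'e) chart \<Rightarrow> 'e \<Rightarrow> 'a" where
  "chart_inv c = inv_into (fst c) (snd c)"

definition charts_at :: "('a, 'e) chart set \<Rightarrow> 'a \<Rightarrow> ('a, 'e) chart set" where
  "charts_at A p = {c \<in> A. p \<in> fst c}"

text \<open>The model space is any finite-dimensional real normed space (rather than a type of class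
  \<open>euclidean_space\<close>), so that manifolds of dimension 0 are included.\<close>

definition smooth_manifold ::
    "'a topology \<Rightarrow> ('a, 'e::real_normed_vector) chart set \<Rightarrow> bool" where
  "smooth_manifold M A \<longleftrightarrow>
     (\<exists>B. finite B \<and> span B = (UNIV :: 'e set)) \<and>
     Hausdorff_space M \<and> second_countable M \<and>
     (\<forall>c\<in>A. openin M (fst c) \<and> open (snd c ` fst c) \<and>
        homeomorphic_map (subtopology M (fst c)) (top_of_set (snd c ` fst c)) (snd c)) \<and>
     (\<Union>c\<in>A. fst c) = topspace M \<and>
     (\<forall>c\<in>A. \<forall>c'\<in>A. smooth_on (snd c' \<circ> chart_inv c) (snd c ` (fst c \<inter> fst c')))"

definition Ck_function :: "nat \<Rightarrow> ('a, 'e::real_normed_vector) chart set \<Rightarrow> ('a \<Rightarrow> real) \<Rightarrow> bool" where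
  "Ck_function k A f \<longleftrightarrow> (\<forall>c\<in>A. Ck_on k (f \<circ> chart_inv c) (snd c ` fst c))"

text \<open>A tangent vector at \<open>p\<close> assigns to each chart around \<open>p\<close> a coordinate vector, the
  coordinate vectors in different charts being related by the derivative of the change of
  coordinates. Charts not containing \<open>p\<close> get the value 0, so that equality of tangent vectors
  is equality of functions.\<close>

type_synonym ('a, 'e) tvec = "('a, 'e) chart \<Rightarrow> 'e"

definition chart_change_deriv ::
    "('a, 'e::real_normed_vector) chart \<Rightarrow> ('a, 'e) chart \<Rightarrow> 'a \<Rightarrow> 'e \<Rightarrow> 'e" where
  "chart_change_deriv c c' p = frechet_derivative (snd c' \<circ> chart_inv c) (at (snd c p))"

definition tangent_space ::
    "('a, 'e::real_normed_vector) chart set \<Rightarrow> 'a \<Rightarrow> ('a, 'e) tvec set" where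
  "tangent_space A p =
     {v. (\<forall>c\<in>charts_at A p. \<forall>c'\<in>charts_at A p. v c' = chart_change_deriv c c' p (v c)) \<and>
         (\<forall>c. c \<notin> charts_at A p \<longrightarrow> v c = 0)}"

text \<open>The tangent vector at \<open>p\<close> whose coordinate vector in the chart \<open>c\<close> is \<open>a\<close>.\<close>

definition tangent_of_coords ::
    "('a, 'e::real_normed_vector) chart set \<Rightarrow> ('a, 'e) chart \<Rightarrow> 'a \<Rightarrow> 'e \<Rightarrow> ('a, 'e) tvec" where
  "tangent_of_coords A c p a =
     (\<lambda>c'. if c' \<in> charts_at A p then chart_change_deriv c c' p a else 0)"

text \<open>By the chain rule the value does not depend on the chart that is chosen.\<close>

definition differential ::
    "('a, 'e::real_normed_vector) chart set \<Rightarrow> ('a \<Rightarrow> real) \<Rightarrow> 'a \<Rightarrow> ('a, 'e) tvec \<Rightarrow> real" where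
  "differential A f p v =
     (let c = (SOME c. c \<in> charts_at A p)
      in frechet_derivative (f \<circ> chart_inv c) (at (snd c p)) (v c))"

type_synonym ('a, 'e) metric_tensor = "'a \<Rightarrow> ('a, 'e) tvec \<Rightarrow> ('a, 'e) tvec \<Rightarrow> real"

definition inner_product_on :: "'v::real_vector set \<Rightarrow> ('v \<Rightarrow> 'v \<Rightarrow> real) \<Rightarrow> bool" where
  "inner_product_on V b \<longleftrightarrow>
     (\<forall>v\<in>V. \<forall>w\<in>V. b v w = b w v) \<and>
     (\<forall>u\<in>V. \<forall>v\<in>V. \<forall>w\<in>V. b (u + v) w = b u w + b v w) \<and>
     (\<forall>r. \<forall>v\<in>V. \<forall>w\<in>V. b (r *\<^sub>R v) w = r * b v w) \<and>
     (\<forall>v\<in>V. v \<noteq> 0 \<longrightarrow> b v v > 0)"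

definition riemannian_metric ::
    "'a topology \<Rightarrow> ('a, 'e::real_normed_vector) chart set \<Rightarrow> ('a, 'e) metric_tensor \<Rightarrow> bool" where
  "riemannian_metric M A G \<longleftrightarrow>
     (\<forall>p\<in>topspace M. inner_product_on (tangent_space A p) (G p)) \<and>
     (\<forall>c\<in>A. \<forall>a b. smooth_on
        (\<lambda>y. let p = chart_inv c y in G p (tangent_of_coords A c p a) (tangent_of_coords A c p b))
        (snd c ` fst c))"

definition tnorm :: "('a, 'e::real_normed_vector) metric_tensor \<Rightarrow> 'a \<Rightarrow> ('a, 'e) tvec \<Rightarrow> real" where
  "tnorm G p v = sqrt (G p v v)"

definition grad ::
    "('a, 'e::real_normed_vector) chart set \<Rightarrow> ('a, 'e) metric_tensor \<Rightarrow> ('a \<Rightarrow> real) \<Rightarrow> 'a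
      \<Rightarrow> ('a, 'e) tvec" where
  "grad A G f p =
     (THE w. w \<in> tangent_space A p \<and> (\<forall>v\<in>tangent_space A p. G p w v = differential A f p v))"

text \<open>Continuous curves on [0,1] that are C^1 off a finite set, as in
  \<open>piecewise_C1_differentiable_on\<close>.\<close>

definition piecewise_C1_curve ::
    "'a topology \<Rightarrow> ('a, 'e::real_normed_vector) chart set \<Rightarrow> (real \<Rightarrow> 'a) \<Rightarrow> bool" where
  "piecewise_C1_curve M A \<sigma> \<longleftrightarrow>
     continuous_map (top_of_set {0..1}) M \<sigma> \<and>
     (\<exists>S. finite S \<and>
        (\<forall>c\<in>A. (snd c \<circ> \<sigma>) C1_differentiable_on {t \<in> {0..1} - S. \<sigma> t \<in> fst c}))"

definition curve_velocity ::
    "('a, 'e::real_normed_vector) chart set \<Rightarrow> (real \<Rightarrow> 'a) \<Rightarrow> real \<Rightarrow> ('a, 'e) tvec" where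
  "curve_velocity A \<sigma> t =
     (\<lambda>c. if c \<in> charts_at A (\<sigma> t) then vector_derivative (snd c \<circ> \<sigma>) (at t) else 0)"

definition curve_length ::
    "('a, 'e::real_normed_vector) chart set \<Rightarrow> ('a, 'e) metric_tensor \<Rightarrow> (real \<Rightarrow> 'a) \<Rightarrow> ennreal" where
  "curve_length A G \<sigma> = (\<integral>\<^sup>+t\<in>{0..1}. ennreal (tnorm G (\<sigma> t) (curve_velocity A \<sigma> t)) \<partial>lborel)"

text \<open>The value is infinite for points of different connected components.\<close>

definition riemannian_dist ::
    "'a topology \<Rightarrow> ('a, 'e::real_normed_vector) chart set \<Rightarrow> ('a, 'e) metric_tensor
      \<Rightarrow> 'a \<Rightarrow> 'a \<Rightarrow> ennreal" where
  "riemannian_dist M A G p q =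
     (INF \<sigma>\<in>{\<sigma>. piecewise_C1_curve M A \<sigma> \<and> \<sigma> 0 = p \<and> \<sigma> 1 = q}. curve_length A G \<sigma>)"

definition complete_riemannian_manifold ::
    "'a topology \<Rightarrow> ('a, 'e::real_normed_vector) chart set \<Rightarrow> ('a, 'e) metric_tensor \<Rightarrow> bool" where
  "complete_riemannian_manifold M A G \<longleftrightarrow>
     smooth_manifold M A \<and> riemannian_metric M A G \<and>
     (\<forall>s :: nat \<Rightarrow> 'a. range s \<subseteq> topspace M \<and>
        (\<forall>e>0. \<exists>N. \<forall>i\<ge>N. \<forall>j\<ge>N. riemannian_dist M A G (s i) (s j) < e) \<longrightarrow>
        (\<exists>l\<in>topspace M. (\<lambda>k. riemannian_dist M A G (s k) l) \<longlonglongrightarrow> 0))"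

abbreviation ineq_idx :: "nat \<Rightarrow> nat set" where
  "ineq_idx n \<equiv> {1..n}"

abbreviation eq_idx :: "nat \<Rightarrow> nat \<Rightarrow> nat set" where
  "eq_idx n m \<equiv> {n + 1..n + m}"

definition feasible ::
    "'a topology \<Rightarrow> nat \<Rightarrow> nat \<Rightarrow> (nat \<Rightarrow> 'a \<Rightarrow> real) \<Rightarrow> (nat \<Rightarrow> 'a \<Rightarrow> real) \<Rightarrow> 'a \<Rightarrow> bool" where
  "feasible M n m g h x \<longleftrightarrow>
     x \<in> topspace M \<and> (\<forall>i\<in>ineq_idx n. g i x \<le> 0) \<and> (\<forall>j\<in>eq_idx n m. h j x = 0)"

definition active_set :: "nat \<Rightarrow> nat \<Rightarrow> (nat \<Rightarrow> 'a \<Rightarrow> real) \<Rightarrow> 'a \<Rightarrow> nat set" where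
  "active_set n m g x = eq_idx n m \<union> {i \<in> ineq_idx n. g i x = 0}"

text \<open>Linear independence is that of the indexed family: repeated gradients are dependent.\<close>

definition LICQ ::
    "('a, 'e::real_normed_vector) chart set \<Rightarrow> ('a, 'e) metric_tensor \<Rightarrow> nat \<Rightarrow> nat
      \<Rightarrow> (nat \<Rightarrow> 'a \<Rightarrow> real) \<Rightarrow> (nat \<Rightarrow> 'a \<Rightarrow> real) \<Rightarrow> 'a \<Rightarrow> bool" where
  "LICQ A G n m g h x \<longleftrightarrow>
     (\<forall>a :: nat \<Rightarrow> real.
        (\<Sum>i\<in>active_set n m g x \<inter> ineq_idx n. a i *\<^sub>R grad A G (g i) x)
          + (\<Sum>j\<in>eq_idx n m. a j *\<^sub>R grad A G (h j) x) = 0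
        \<longrightarrow> (\<forall>i\<in>active_set n m g x. a i = 0))"

definition KKT ::
    "'a topology \<Rightarrow> ('a, 'e::real_normed_vector) chart set \<Rightarrow> ('a, 'e) metric_tensor \<Rightarrow> nat \<Rightarrow> nat
      \<Rightarrow> ('a \<Rightarrow> real) \<Rightarrow> (nat \<Rightarrow> 'a \<Rightarrow> real) \<Rightarrow> (nat \<Rightarrow> 'a \<Rightarrow> real) \<Rightarrow> 'a \<Rightarrow> bool" where
  "KKT M A G n m f g h x \<longleftrightarrow> x \<in> topspace M \<and>
     (\<exists>lam \<gamma> :: nat \<Rightarrow> real.
        grad A G f x + (\<Sum>i\<in>ineq_idx n. lam i *\<^sub>R grad A G (g i) x)
          + (\<Sum>j\<in>eq_idx n m. \<gamma> j *\<^sub>R grad A G (h j) x) = 0 \<and>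
        (\<forall>j\<in>eq_idx n m. h j x = 0) \<and>
        (\<forall>i\<in>ineq_idx n. g i x \<le> 0 \<and> lam i \<ge> 0 \<and> lam i * g i x = 0))"

definition Q_lse ::
    "nat \<Rightarrow> nat \<Rightarrow> ('a \<Rightarrow> real) \<Rightarrow> (nat \<Rightarrow> 'a \<Rightarrow> real) \<Rightarrow> (nat \<Rightarrow> 'a \<Rightarrow> real)
      \<Rightarrow> 'a \<Rightarrow> real \<Rightarrow> real \<Rightarrow> real" where
  "Q_lse n m f g h x \<rho> u =
     f x + \<rho> * (\<Sum>i\<in>ineq_idx n. u * ln (1 + exp (g i x / u)))
         + \<rho> * (\<Sum>j\<in>eq_idx n m. u * ln (exp (h j x / u) + exp (- h j x / u)))"

definition huber_penalty :: "real \<Rightarrow> real \<Rightarrow> real" where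
  "huber_penalty t u =
     (if t \<le> 0 then 0 else if t \<le> u then t\<^sup>2 / (2 * u) else t - u / 2)"

definition Q_lqh ::
    "nat \<Rightarrow> nat \<Rightarrow> ('a \<Rightarrow> real) \<Rightarrow> (nat \<Rightarrow> 'a \<Rightarrow> real) \<Rightarrow> (nat \<Rightarrow> 'a \<Rightarrow> real)
      \<Rightarrow> 'a \<Rightarrow> real \<Rightarrow> real \<Rightarrow> real" where
  "Q_lqh n m f g h x \<rho> u =
     f x + \<rho> * (\<Sum>i\<in>ineq_idx n. huber_penalty (g i x) u)
         + \<rho> * (\<Sum>j\<in>eq_idx n m. sqrt ((h j x)\<^sup>2 + u\<^sup>2))"

record repms_params =
  eps_min :: real
  eps_init :: real
  rho_init :: real
  u_init :: real
  u_min :: real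
  theta_eps :: real
  theta_u :: real
  theta_rho :: real
  tau :: real
  d_min :: real
  update_rho :: bool

definition valid_params :: "repms_params \<Rightarrow> bool" where
  "valid_params P \<longleftrightarrow>
     eps_min P \<ge> 0 \<and> eps_init P > 0 \<and> rho_init P > 0 \<and> u_init P > 0 \<and> u_min P \<ge> 0 \<and>
     0 < theta_eps P \<and> theta_eps P < 1 \<and> 0 < theta_u P \<and> theta_u P < 1 \<and> theta_rho P > 1 \<and>
     tau P \<ge> 0 \<and> d_min P \<ge> 0"

definition max_violation ::
    "nat \<Rightarrow> nat \<Rightarrow> (nat \<Rightarrow> 'a \<Rightarrow> real) \<Rightarrow> (nat \<Rightarrow> 'a \<Rightarrow> real) \<Rightarrow> 'a \<Rightarrow> real" where
  "max_violation n m g h x =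
     Max ((\<lambda>j. \<bar>h j x\<bar>) ` eq_idx n m \<union> (\<lambda>i. g i x) ` ineq_idx n)"

text \<open>The termination test in iteration \<open>k\<close>, evaluated after the subsolver has returned
  \<open>x (Suc k)\<close>.\<close>

definition repms_stop ::
    "'a topology \<Rightarrow> ('a, 'e::real_normed_vector) chart set \<Rightarrow> ('a, 'e) metric_tensor \<Rightarrow> repms_params
      \<Rightarrow> (nat \<Rightarrow> 'a) \<Rightarrow> (nat \<Rightarrow> real) \<Rightarrow> (nat \<Rightarrow> real) \<Rightarrow> nat \<Rightarrow> bool" where
  "repms_stop M A G P x \<epsilon> u k \<longleftrightarrow>
     riemannian_dist M A G (x k) (x (Suc k)) < ennreal (d_min P) \<and> \<epsilon> k \<le> eps_min P \<and> u k \<le> u_min P"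

text \<open>The sequences are iterates of the algorithm: iteration \<open>k\<close> is constrained only if no earlier
  iteration has terminated, and the entries after termination are arbitrary. The subsolver is
  only known to return a point satisfying its stopping criterion. Without constraints
  (\<open>n + m = 0\<close>) the maximal violation is taken to lie below every threshold.\<close>

definition repms_run ::
    "'a topology \<Rightarrow> ('a, 'e::real_normed_vector) chart set \<Rightarrow> ('a, 'e) metric_tensor \<Rightarrow> nat \<Rightarrow> nat
      \<Rightarrow> (nat \<Rightarrow> 'a \<Rightarrow> real) \<Rightarrow> (nat \<Rightarrow> 'a \<Rightarrow> real) \<Rightarrow> ('a \<Rightarrow> real \<Rightarrow> real \<Rightarrow> real) \<Rightarrow> repms_params
      \<Rightarrow> (nat \<Rightarrow> 'a) \<Rightarrow> (nat \<Rightarrow> real) \<Rightarrow> (nat \<Rightarrow> real) \<Rightarrow> (nat \<Rightarrow> real) \<Rightarrow> bool" where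
  "repms_run M A G n m g h Q P x \<epsilon> u \<rho> \<longleftrightarrow>
     x 0 \<in> topspace M \<and> \<epsilon> 0 = eps_init P \<and> u 0 = u_init P \<and> \<rho> 0 = rho_init P \<and>
     (\<forall>k. (\<forall>j<k. \<not> repms_stop M A G P x \<epsilon> u j) \<longrightarrow>
        x (Suc k) \<in> topspace M \<and>
        tnorm G (x (Suc k)) (grad A G (\<lambda>y. Q y (\<rho> k) (u k)) (x (Suc k))) \<le> \<epsilon> k \<and>
        (\<not> repms_stop M A G P x \<epsilon> u k \<longrightarrow>
           \<epsilon> (Suc k) = max (eps_min P) (theta_eps P * \<epsilon> k) \<and>
           u (Suc k) = max (u_min P) (theta_u P * u k) \<and>
           \<rho> (Suc k) =
             (if update_rho P \<and> (k = 0 \<or> n + m > 0 \<and> max_violation n m g h (x (Suc k)) \<ge> tau P)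
              then theta_rho P * \<rho> k else \<rho> k)))"

end

theory Submission
  imports Defs
begin

text \<open>
  Since the penalty parameter \<open>\<rho>\<close> is fixed and the derivatives of the smoothed penalties are bounded
  by 1, the multipliers \<open>\<lambda>\<^sub>i = \<rho> \<phi>'(g\<^sub>i(x\<^sub>k), u\<^sub>k)\<close> and \<open>\<gamma>\<^sub>j = \<rho> \<psi>'(h\<^sub>j(x\<^sub>k), u\<^sub>k)\<close>, for which
  \<open>grad Q\<close> is the gradient of the Lagrangian, stay in \<open>[-\<rho>, \<rho>]\<close> and converge along a subsequence.
  In a chart around the limit point, the stopping criterion and Cauchy--Schwarz force every fixed
  coordinate derivative of \<open>Q\<close> at \<open>x\<^sub>k\<close> to tend to 0, so the limit multipliers make the Lagrangian
  stationary. For an inactive constraint \<open>\<phi>' \<le> u\<^sub>k / |g\<^sub>i(x\<^sub>k)| \<rightarrow> 0\<close>, which gives complementarity.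
\<close>

section \<open>Inner products on subspaces\<close>

lemma inner_product_onD:
  assumes "inner_product_on V b"
  shows inner_product_on_commute: "v \<in> V \<Longrightarrow> w \<in> V \<Longrightarrow> b v w = b w v"
    and inner_product_on_add:
      "v \<in> V \<Longrightarrow> v' \<in> V \<Longrightarrow> w \<in> V \<Longrightarrow> b (v + v') w = b v w + b v' w"
    and inner_product_on_scale: "v \<in> V \<Longrightarrow> w \<in> V \<Longrightarrow> b (t *\<^sub>R v) w = t * b v w"
    and inner_product_on_pos: "v \<in> V \<Longrightarrow> v \<noteq> 0 \<Longrightarrow> b v v > 0"
  using assms unfolding inner_product_on_def by simp_all

lemma inner_product_on_nonneg:
  assumes b: "inner_product_on V b" and v: "v \<in> V"
  shows "b v v \<ge> 0"
proof (cases "v = 0")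
  case True
  then show ?thesis using inner_product_on_scale[OF b v v, of 0] by simp
next
  case False
  then show ?thesis using inner_product_on_pos[OF b v] by simp
qed

text \<open>Tangent spaces are subsets of a function type, so \<open>b\<close> is a plain function
  and every manipulation has to stay inside \<open>V\<close>. For \<open>w \<noteq> 0\<close> the
  bound is \<open>b z z \<ge> 0\<close>, where \<open>z\<close> is the residual of projecting
  \<open>v\<close> onto \<open>w\<close>.\<close>

lemma inner_product_on_Cauchy_Schwarz:
  assumes b: "inner_product_on V b" and V: "subspace V" and v: "v \<in> V" and w: "w \<in> V"
  shows "\<bar>b v w\<bar> \<le> sqrt (b v v) * sqrt (b w w)"
proof -
  have sym: "b x y = b y x" and add: "b (x + z) y = b x y + b z y"
    and scale: "b (t *\<^sub>R x) y = t * b x y"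
    if "x \<in> V" "y \<in> V" "z \<in> V" for x y z t
    using that inner_product_on_commute[OF b] inner_product_on_add[OF b]
      inner_product_on_scale[OF b] by blast+
  have "(b v w)\<^sup>2 \<le> b v v * b w w"
  proof (cases "w = 0")
    case True
    then show ?thesis using scale[of w v w 0] sym[OF v w w] scale[of w w w 0] v w by simp
  next
    case False
    then have pos: "b w w > 0" using inner_product_on_pos[OF b w] by simp
    define t where "t = b v w / b w w"
    define z where "z = v + (- t) *\<^sub>R w"
    have tw: "(- t) *\<^sub>R w \<in> V" and z: "z \<in> V"
      unfolding z_def by (intro subspace_add[OF V] subspace_scale[OF V] v w)+
    have zv: "b z v = b v v - t * b v w"
      unfolding z_def using add[OF v v tw] scale[OF w v w, of "-t"] sym[OF v w w] by simp
    have zw: "b z w = 0"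
      unfolding z_def using add[OF v w tw] scale[OF w w w, of "-t"] pos by (simp add: t_def)
    have "b z z = b v z + (- t) * b w z"
      using add[OF v z tw] scale[OF w z w, of "-t"] unfolding z_def[symmetric] by simp
    also have "\<dots> = b v v - t * b v w" using zv zw sym[OF v z v] sym[OF w z w] by simp
    finally have "b v v - t * b v w \<ge> 0" using inner_product_on_nonneg[OF b z] by simp
    then show ?thesis using pos by (simp add: t_def field_simps power2_eq_square)
  qed
  then have "sqrt ((b v w)\<^sup>2) \<le> sqrt (b v v * b w w)" by (rule real_sqrt_le_mono)
  then show ?thesis by (simp add: real_sqrt_mult)
qed

lemma inner_product_on_sum:
  assumes b: "inner_product_on V b" and V: "subspace V" and w: "w \<in> V"
    and v: "\<And>i. i \<in> I \<Longrightarrow> v i \<in> V"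
  shows "b (\<Sum>i\<in>I. a i *\<^sub>R v i) w = (\<Sum>i\<in>I. a i * b (v i) w)"
proof -
  have zero: "b 0 w = 0"
    using inner_product_on_scale[OF b w w, of 0] by simp
  show ?thesis
  proof (cases "finite I")
    case True
    then show ?thesis using v
    proof (induction I rule: finite_induct)
      case (insert j J)
      have "a j *\<^sub>R v j \<in> V" using insert.prems V by (simp add: subspace_scale)
      moreover have "(\<Sum>i\<in>J. a i *\<^sub>R v i) \<in> V"
        using insert.prems V by (intro subspace_sum subspace_scale) auto
      moreover have "v j \<in> V" using insert.prems by simp
      ultimately show ?case
        using inner_product_on_add[OF b _ _ w] inner_product_on_scale[OF b _ w]
          insert.IH insert.prems insert.hyps by simp
    qed (simp add: zero)
  qed (simp add: zero)
qed

lemma inner_product_on_subset: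
  "inner_product_on V b \<Longrightarrow> W \<subseteq> V \<Longrightarrow> inner_product_on W b"
  by (simp add: inner_product_on_def subset_iff)

text \<open>Supplies the existence half of the gradient. Gram-Schmidt induction over the spanning
  set; \<open>l\<close> is generalised because the induction hypothesis is used both for
  \<open>l\<close> and for the functional \<open>b s\<close>.\<close>

lemma inner_product_on_riesz:
  assumes "finite S" and "inner_product_on (span S) b"
    and "\<And>v w. v \<in> span S \<Longrightarrow> w \<in> span S \<Longrightarrow> l (v + w) = l v + l w"
    and "\<And>t v. v \<in> span S \<Longrightarrow> l (t *\<^sub>R v) = t * (l v :: real)"
  shows "\<exists>w\<in>span S. \<forall>v\<in>span S. b w v = l v"
  using assms
proof (induction S arbitrary: l rule: finite_induct)
  case empty
  have "b 0 0 = 0"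
    using inner_product_on_scale[OF empty.prems(1), of 0 0 0] by simp
  moreover have "l 0 = 0" using empty.prems(3)[of 0 0] by simp
  ultimately show ?case by simp
next
  case (insert s S)
  have sub: "span S \<subseteq> span (insert s S)" by (simp add: span_mono subset_insertI)
  have ip: "inner_product_on (span (insert s S)) b" and ipS: "inner_product_on (span S) b"
    using insert.prems(1) sub by (auto intro: inner_product_on_subset)
  show ?case
  proof (cases "s \<in> span S")
    case True
    then have eq: "span (insert s S) = span S" by (rule span_redundant)
    show ?thesis
      unfolding eq by (rule insert.IH[OF ipS]) (use insert.prems(2,3)[unfolded eq] in blast)+
  next
    case False
    let ?V = "span (insert s S)"
    have sym: "b x y = b y x" and add: "b (x + z) y = b x y + b z y"
      and scale: "b (t *\<^sub>R x) y = t * b x y"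
      if "x \<in> ?V" "y \<in> ?V" "z \<in> ?V" for x y z t
      using that inner_product_on_commute[OF ip] inner_product_on_add[OF ip]
        inner_product_on_scale[OF ip] by blast+
    have addr: "b x (y + z) = b x y + b x z" and scaler: "b x (t *\<^sub>R y) = t * b x y"
      if "x \<in> ?V" "y \<in> ?V" "z \<in> ?V" for x y z t
      using that add[of y x z] scale[of y x z] sym[of x] by (simp_all add: span_add span_scale)
    have s: "s \<in> ?V" by (simp add: span_base)
    \<comment> \<open>Representing the functional \<open>b s\<close> on \<open>span S\<close> yields
      the orthogonal projection \<open>p\<close> of \<open>s\<close>.\<close>
    have "\<exists>p\<in>span S. \<forall>v\<in>span S. b p v = b s v"
      by (rule insert.IH[OF ipS]) (use s addr scaler sub in \<open>auto simp: subset_iff\<close>)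
    then obtain p where p: "p \<in> span S" "\<And>v. v \<in> span S \<Longrightarrow> b p v = b s v" by blast
    have "\<exists>w\<in>span S. \<forall>v\<in>span S. b w v = l v"
      by (rule insert.IH[OF ipS]) (use insert.prems sub in \<open>auto simp: subset_iff\<close>)
    then obtain w0 where w0: "w0 \<in> span S" "\<And>v. v \<in> span S \<Longrightarrow> b w0 v = l v" by blast
    define s' where "s' = s - p"
    have s': "s' \<in> ?V" using s p sub by (auto simp: s'_def intro: span_diff)
    have "s' \<noteq> 0" using False p by (auto simp: s'_def)
    then have pos: "b s' s' > 0" using inner_product_on_pos[OF ip s'] by simp
    have orth: "b s' v = 0" if "v \<in> span S" for v
    proof -
      have "b s v = b s' v + b p v"
        using add[of s' v p] s' that p sub by (auto simp: s'_def)
      then show ?thesis using p that by simp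
    qed
    \<comment> \<open>This coefficient is forced by \<open>b w s' = l s'\<close>. Since
      \<open>s'\<close> is orthogonal to \<open>span S\<close>, adding \<open>a *\<^sub>R s'\<close>
      to \<open>w0\<close> changes no value on \<open>span S\<close>, and \<open>w0\<close>
      contributes nothing at \<open>s'\<close>.\<close>
    define a where "a = l s' / b s' s'"
    define w where "w = w0 + a *\<^sub>R s'"
    have as: "a *\<^sub>R s' \<in> ?V" using s' by (rule span_scale)
    have w0V: "w0 \<in> ?V" using w0 sub by auto
    have wV: "w \<in> ?V" unfolding w_def using w0V as by (rule span_add)
    have "b w v = l v" if v: "v \<in> ?V" for v
    proof -
      obtain k where k: "v - k *\<^sub>R s \<in> span S" using span_breakdown_eq[of v s S] v by auto
      \<comment> \<open>The component of \<open>v\<close> in \<open>span S\<close> once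
        \<open>s'\<close> replaces \<open>s\<close> as the extra generator.\<close>
      define q where "q = v - k *\<^sub>R s'"
      have "q = (v - k *\<^sub>R s) + k *\<^sub>R p" by (simp add: q_def s'_def algebra_simps)
      then have q: "q \<in> span S" using k p by (simp add: span_add span_scale)
      have qV: "q \<in> ?V" using q sub by auto
      have ks: "k *\<^sub>R s' \<in> ?V" using s' by (rule span_scale)
      have veq: "v = q + k *\<^sub>R s'" by (simp add: q_def)
      have "b w q = l q"
        using add[OF w0V qV as] scale[OF s' qV s'] orth[OF q] w0(2)[OF q] by (simp add: w_def)
      moreover have "b w s' = l s'"
        using add[OF w0V s' as] scale[OF s' s' s', of a] orth[OF w0(1)] sym[OF w0V s' s'] pos
        by (simp add: w_def a_def)
      ultimately show ?thesis
        unfolding veq using addr[OF wV qV ks] scaler[OF wV s' s', of k] insert.prems(2)[OF qV ks]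
          insert.prems(3)[OF s', of k] by simp
    qed
    then show ?thesis using wV by blast
  qed
qed

section \<open>Charts, tangent spaces and gradients\<close>

lemma Ck_on_Suc_differentiable_at:
  "Ck_on (Suc k) F S \<Longrightarrow> open S \<Longrightarrow> y \<in> S \<Longrightarrow> F differentiable (at y)"
  unfolding Ck_on.simps(2) differentiable_on_def by (metis at_within_open)

lemma Ck_on_2_continuous_derivative:
  "Ck_on 2 F S \<Longrightarrow> continuous_on S (\<lambda>y. frechet_derivative F (at y) v)"
  unfolding numeral_2_eq_2 Ck_on.simps(2) by (blast intro: differentiable_imp_continuous_on)

context
  fixes M :: "'a topology" and A :: "('a, 'e::real_normed_vector) chart set"
  assumes mfd: "smooth_manifold M A"
begin

section \<open>Charts and transition maps\<close>

lemma chart_homeomorphic: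
  assumes "c \<in> A"
  shows "openin M (fst c)" "open (snd c ` fst c)"
    "homeomorphic_map (subtopology M (fst c)) (top_of_set (snd c ` fst c)) (snd c)"
  using mfd assms unfolding smooth_manifold_def by blast+

lemma chart_inv_snd:
  assumes "c \<in> A" "q \<in> fst c"
  shows "chart_inv c (snd c q) = q"
proof -
  have "inj_on (snd c) (fst c)"
    using homeomorphic_imp_injective_map[OF chart_homeomorphic(3)] chart_homeomorphic(1) assms(1)
    by (metis openin_subset topspace_subtopology_subset)
  then show ?thesis using assms(2) by (simp add: chart_inv_def)
qed

text \<open>Applied to chart overlaps: their coordinate images are open, so transition maps can be
  differentiated without restriction to a set.\<close>

lemma open_chart_image:
  assumes "c \<in> A" "openin M W"
  shows "open (snd c ` (fst c \<inter> W))"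
proof -
  have "openin (subtopology M (fst c)) (fst c \<inter> W)"
    using assms(2) openin_subtopology_Int2 by blast
  then have "openin (top_of_set (snd c ` fst c)) (snd c ` (fst c \<inter> W))"
    using homeomorphic_map_openness_eq[OF chart_homeomorphic(3)] assms(1) by blast
  then show ?thesis using chart_homeomorphic(2) assms(1) openin_open_eq by blast
qed

lemma transition_has_derivative:
  assumes "c \<in> charts_at A p" "c' \<in> charts_at A p"
  shows "(snd c' \<circ> chart_inv c has_derivative chart_change_deriv c c' p) (at (snd c p))"
proof -
  have c: "c \<in> A" "c' \<in> A" "p \<in> fst c" "p \<in> fst c'" using assms by (auto simp: charts_at_def)
  have "Ck_on (Suc 0) (snd c' \<circ> chart_inv c) (snd c ` (fst c \<inter> fst c'))"
    using mfd c unfolding smooth_manifold_def smooth_on_def by blast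
  then have "(snd c' \<circ> chart_inv c) differentiable at (snd c p)"
    by (rule Ck_on_Suc_differentiable_at)
      (use c open_chart_image[OF c(1) chart_homeomorphic(1)[OF c(2)]] in auto)
  then show ?thesis unfolding chart_change_deriv_def by (simp add: frechet_derivative_works)
qed

text \<open>Chain rule: \<open>chart_inv c\<close> factors through the coordinates of
  \<open>c'\<close>, but only on the overlap, hence the transformation within an open set.
  \<open>F\<close> may be vector-valued, so coordinate maps are covered too.\<close>

lemma change_of_chart_has_derivative:
  assumes c: "c \<in> charts_at A p" and c': "c' \<in> charts_at A p"
    and F: "(F \<circ> chart_inv c' has_derivative D) (at (snd c' p))"
  shows "(F \<circ> chart_inv c has_derivative D \<circ> chart_change_deriv c c' p) (at (snd c p))"
proof -
  have cc: "c \<in> A" "c' \<in> A" "p \<in> fst c" "p \<in> fst c'" using c c' by (auto simp: charts_at_def)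
  have eq: "(snd c' \<circ> chart_inv c) (snd c p) = snd c' p" using chart_inv_snd cc by simp
  have "((F \<circ> chart_inv c') \<circ> (snd c' \<circ> chart_inv c) has_derivative
      D \<circ> chart_change_deriv c c' p) (at (snd c p))"
    by (rule diff_chain_at[OF transition_has_derivative[OF c c']]) (use F eq in simp)
  then show ?thesis
    by (rule has_derivative_transform_within_open
          [OF _ open_chart_image[OF cc(1) chart_homeomorphic(1)[OF cc(2)]]])
       (use cc chart_inv_snd[OF cc(1)] chart_inv_snd[OF cc(2)] in auto)
qed

text \<open>Cocycle identity: the same transition map is differentiated once directly and once
  through \<open>c'\<close>, and derivatives are unique.\<close>

lemma chart_change_deriv_comp:
  assumes "c \<in> charts_at A p" "c' \<in> charts_at A p" "c'' \<in> charts_at A p"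
  shows "chart_change_deriv c c'' p a = chart_change_deriv c' c'' p (chart_change_deriv c c' p a)"
  using fun_cong[OF has_derivative_unique[OF transition_has_derivative[OF assms(1,3)]
      change_of_chart_has_derivative[OF assms(1,2) transition_has_derivative[OF assms(2,3)]]]]
  unfolding o_apply .

lemma chart_change_deriv_self:
  assumes "c \<in> charts_at A p"
  shows "chart_change_deriv c c p a = a"
proof -
  have c: "c \<in> A" "p \<in> fst c" using assms by (auto simp: charts_at_def)
  have "((\<lambda>y. y) has_derivative (\<lambda>y. y)) (at (snd c p))" by (rule has_derivative_ident)
  then have "(snd c \<circ> chart_inv c has_derivative (\<lambda>y. y)) (at (snd c p))"
    by (rule has_derivative_transform_within_open[OF _ chart_homeomorphic(2)[OF c(1)]])
       (use c chart_inv_snd[OF c(1)] in auto)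
  from fun_cong[OF has_derivative_unique[OF transition_has_derivative[OF assms assms] this]]
  show ?thesis .
qed

lemma linear_chart_change_deriv:
  assumes "c \<in> charts_at A p" "c' \<in> charts_at A p"
  shows "linear (chart_change_deriv c c' p)"
  by (rule has_derivative_linear[OF transition_has_derivative[OF assms]])

section \<open>Tangent vectors in coordinates\<close>

lemma linear_tangent_of_coords:
  assumes "c \<in> charts_at A p"
  shows "linear (tangent_of_coords A c p)"
proof (rule linearI; rule ext)
  fix a b :: 'e and t c'
  show "tangent_of_coords A c p (a + b) c' = (tangent_of_coords A c p a + tangent_of_coords A c p b) c'"
    using linear_add[OF linear_chart_change_deriv[OF assms]] by (simp add: tangent_of_coords_def)
  show "tangent_of_coords A c p (t *\<^sub>R a) c' = (t *\<^sub>R tangent_of_coords A c p a) c'"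
    using linear_scale[OF linear_chart_change_deriv[OF assms]]
    by (simp add: tangent_of_coords_def scaleR_fun_def)
qed

text \<open>One chart determines a tangent vector, and by the cocycle identity every coordinate
  vector occurs. This transfers finite dimension and linearity from the model space.\<close>

lemma tangent_space_eq_range:
  assumes c: "c \<in> charts_at A p"
  shows "tangent_space A p = range (tangent_of_coords A c p)"
proof (intro equalityI subsetI)
  fix v assume v: "v \<in> tangent_space A p"
  have "v = tangent_of_coords A c p (v c)"
  proof
    fix c'
    show "v c' = tangent_of_coords A c p (v c) c'"
    proof (cases "c' \<in> charts_at A p")
      case True
      then have "v c' = chart_change_deriv c c' p (v c)"
        using v c unfolding tangent_space_def by blast
      with True show ?thesis unfolding tangent_of_coords_def by simp
    next
      case False
      then have "v c' = 0" using v unfolding tangent_space_def by blast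
      with False show ?thesis by (simp add: tangent_of_coords_def)
    qed
  qed
  then show "v \<in> range (tangent_of_coords A c p)" by blast
next
  fix v assume "v \<in> range (tangent_of_coords A c p)"
  then obtain a where v: "v = tangent_of_coords A c p a" by blast
  show "v \<in> tangent_space A p"
    unfolding tangent_space_def v
    by (simp add: tangent_of_coords_def) (blast intro: chart_change_deriv_comp[OF c])
qed

lemma subspace_tangent_space:
  assumes "c \<in> charts_at A p"
  shows "subspace (tangent_space A p)"
  unfolding tangent_space_eq_range[OF assms]
  by (rule linear_subspace_image[OF linear_tangent_of_coords[OF assms] subspace_UNIV])

lemma tangent_space_finite_span:
  assumes "c \<in> charts_at A p"
  obtains S where "finite S" "tangent_space A p = span S"
proof -
  obtain B where B: "finite B" "span B = (UNIV :: 'e set)"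
    using mfd unfolding smooth_manifold_def by blast
  have "tangent_space A p = span (tangent_of_coords A c p ` B)"
    using tangent_space_eq_range[OF assms] linear_span_image[OF linear_tangent_of_coords[OF assms]]
      B(2) by metis
  then show thesis using that B(1) by blast
qed

section \<open>Differentials and gradients\<close>

lemma differential_tangent_of_coords:
  assumes c: "c \<in> charts_at A p" and F: "(F \<circ> chart_inv c has_derivative D) (at (snd c p))"
  shows "differential A F p (tangent_of_coords A c p a) = D a"
proof -
  \<comment> \<open>The chart in which \<open>differential\<close> evaluates. The derivative there
    is \<open>D\<close> after the change from \<open>c0\<close> to \<open>c\<close>, while the
    coordinates of the vector come from the change from \<open>c\<close> to \<open>c0\<close>; the
    two changes cancel.\<close>
  define c0 where "c0 = (SOME c. c \<in> charts_at A p)"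
  have c0: "c0 \<in> charts_at A p" unfolding c0_def using c by (rule someI)
  have "frechet_derivative (F \<circ> chart_inv c0) (at (snd c0 p)) = D \<circ> chart_change_deriv c0 c p"
    using change_of_chart_has_derivative[OF c0 c F] frechet_derivative_at by metis
  moreover have "tangent_of_coords A c p a c0 = chart_change_deriv c c0 p a"
    using c0 by (simp add: tangent_of_coords_def)
  ultimately show ?thesis
    using chart_change_deriv_comp[OF c c0 c] chart_change_deriv_self[OF c]
    by (simp add: differential_def Let_def flip: c0_def)
qed

text \<open>Riesz representation gives existence and positive definiteness gives uniqueness, so the
  definite description in \<open>grad\<close> denotes a vector.\<close>

lemma grad_works:
  assumes G: "inner_product_on (tangent_space A p) (G p)" and c: "c \<in> charts_at A p"
    and F: "(F \<circ> chart_inv c has_derivative D) (at (snd c p))"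
  shows grad_in_tangent_space: "grad A G F p \<in> tangent_space A p"
    and inner_grad: "G p (grad A G F p) (tangent_of_coords A c p a) = D a"
proof -
  let ?V = "tangent_space A p" and ?T = "tangent_of_coords A c p"
  note d = differential_tangent_of_coords[OF c F]
  note lT = linear_tangent_of_coords[OF c]
  have lD: "linear D" using F by (rule has_derivative_linear)
  obtain S where S: "finite S" "?V = span S" by (rule tangent_space_finite_span[OF c])
  have r: "span S = range ?T" using S(2) tangent_space_eq_range[OF c] by simp
  have ex: "\<exists>w\<in>?V. \<forall>v\<in>?V. G p w v = differential A F p v"
    unfolding S(2)
  proof (rule inner_product_on_riesz[OF S(1)], goal_cases)
    case 1
    then show ?case using G S(2) by simp
  next
    case (2 v w)
    then obtain a b where "v = ?T a" "w = ?T b" unfolding r by blast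
    then show ?case using d lD by (simp add: linear_add flip: linear_add[OF lT])
  next
    case (3 t v)
    then obtain a where "v = ?T a" unfolding r by blast
    then show ?case using d lD by (simp add: linear_scale flip: linear_scale[OF lT])
  qed
  have "\<exists>!w. w \<in> ?V \<and> (\<forall>v\<in>?V. G p w v = differential A F p v)"
  proof (rule ex_ex1I)
    fix w w'
    assume w: "w \<in> ?V \<and> (\<forall>v\<in>?V. G p w v = differential A F p v)"
      and w': "w' \<in> ?V \<and> (\<forall>v\<in>?V. G p w' v = differential A F p v)"
    have sub: "w - w' \<in> ?V" using subspace_diff[OF subspace_tangent_space[OF c]] w w' by blast
    \<comment> \<open>Splitting \<open>w\<close> this way needs additivity only. Both vectors
      represent the same functional, so the squared length of their difference vanishes.\<close>
    have "G p ((w - w') + w') (w - w') = G p (w - w') (w - w') + G p w' (w - w')"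
      using inner_product_on_add[OF G sub _ sub] w' by blast
    then have "G p (w - w') (w - w') = 0" using w w' sub by simp
    then show "w = w'"
      using inner_product_on_pos[OF G sub] by auto
  qed (use ex in blast)
  note gr = theI'[OF this, folded grad_def]
  show "grad A G F p \<in> ?V" using gr by blast
  show "G p (grad A G F p) (?T a) = D a"
    using gr d tangent_space_eq_range[OF c] by auto
qed

section \<open>Limits read in a chart\<close>

lemma chart_tendsto:
  assumes "c \<in> charts_at A p" and "limitin M s p F"
  shows "\<forall>\<^sub>F k in F. s k \<in> fst c" and "((\<lambda>k. snd c (s k)) \<longlongrightarrow> snd c p) F"
proof -
  have c: "c \<in> A" "p \<in> fst c" using assms(1) by (auto simp: charts_at_def)
  show "\<forall>\<^sub>F k in F. s k \<in> fst c"
    using assms(2) chart_homeomorphic(1)[OF c(1)] c(2) by (simp add: limitin_def)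
  have cont: "continuous_map (subtopology M (fst c)) euclidean (snd c)"
    using chart_homeomorphic(3)[OF c(1)] homeomorphic_imp_continuous_map
      continuous_map_in_subtopology by blast
  show "((\<lambda>k. snd c (s k)) \<longlongrightarrow> snd c p) F"
  proof (rule topological_tendstoI)
    fix W assume W: "open W" "snd c p \<in> W"
    \<comment> \<open>The part of the chart domain sent into \<open>W\<close>. It is open in
      \<open>M\<close> because the domain itself is, so convergence in \<open>M\<close> applies to
      it.\<close>
    let ?W = "{q \<in> topspace (subtopology M (fst c)). snd c q \<in> W}"
    have "openin (subtopology M (fst c)) ?W"
      using cont W(1) by (simp add: continuous_map_def)
    then have "openin M ?W"
      using chart_homeomorphic(1)[OF c(1)] openin_trans_full by blast
    moreover have "p \<in> ?W" using W c assms(2) by (auto simp: limitin_def)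
    ultimately have "\<forall>\<^sub>F k in F. s k \<in> ?W" using assms(2) unfolding limitin_def by blast
    then show "\<forall>\<^sub>F k in F. snd c (s k) \<in> W" by (rule eventually_mono) simp
  qed
qed

lemma chart_continuous_tendsto:
  assumes c: "c \<in> charts_at A p" and s: "limitin M s p F"
    and H: "continuous_on (snd c ` fst c) H"
  shows "((\<lambda>k. H (snd c (s k))) \<longlongrightarrow> H (snd c p)) F"
proof (rule continuous_on_tendsto_compose[OF H chart_tendsto(2)[OF c s]])
  show "snd c p \<in> snd c ` fst c" using c by (simp add: charts_at_def)
  show "\<forall>\<^sub>F k in F. snd c (s k) \<in> snd c ` fst c"
    using chart_tendsto(1)[OF c s] by (rule eventually_mono) simp
qed

text \<open>Here \<open>H\<close> lives on the manifold. \<open>chart_inv c\<close> undoes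
  \<open>snd c\<close> only once the points have entered \<open>fst c\<close>, so the coordinate
  expression agrees with \<open>H\<close> eventually.\<close>

lemma chart_continuous_tendsto':
  assumes c: "c \<in> charts_at A p" and s: "limitin M s p F"
    and H: "continuous_on (snd c ` fst c) (\<lambda>y. H (chart_inv c y))"
  shows "((\<lambda>k. H (s k)) \<longlongrightarrow> H p) F"
proof -
  have cA: "c \<in> A" "p \<in> fst c" using c by (auto simp: charts_at_def)
  have "((\<lambda>k. H (chart_inv c (snd c (s k)))) \<longlongrightarrow> H p) F"
    using chart_continuous_tendsto[OF c s H] chart_inv_snd[OF cA] by simp
  then show ?thesis
    by (rule Lim_transform_eventually)
      (use chart_tendsto(1)[OF c s] chart_inv_snd[OF cA(1)] in \<open>auto elim: eventually_mono\<close>)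
qed

lemma C2_function_has_derivative:
  assumes "Ck_function 2 A F" and "c \<in> charts_at A p"
  shows "(F \<circ> chart_inv c has_derivative frechet_derivative (F \<circ> chart_inv c) (at (snd c p)))
    (at (snd c p))"
proof -
  have c: "c \<in> A" "p \<in> fst c" using assms(2) by (auto simp: charts_at_def)
  have "Ck_on (Suc (Suc 0)) (F \<circ> chart_inv c) (snd c ` fst c)"
    using assms(1) c(1) unfolding Ck_function_def numeral_2_eq_2 by blast
  from Ck_on_Suc_differentiable_at[OF this chart_homeomorphic(2)[OF c(1)]] c(2)
  show ?thesis by (simp add: frechet_derivative_works)
qed

text \<open>A directional derivative with fixed \<open>a\<close> is itself differentiable in the
  base point, hence continuous. These limits carry the stationarity relation over to the limit
  point.\<close>

lemma C2_function_tendsto: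
  assumes F: "Ck_function 2 A F" and c: "c \<in> charts_at A p" and s: "limitin M s p \<F>"
  shows "((\<lambda>k. F (s k)) \<longlongrightarrow> F p) \<F>"
    and "((\<lambda>k. frechet_derivative (F \<circ> chart_inv c) (at (snd c (s k))) a)
      \<longlongrightarrow> frechet_derivative (F \<circ> chart_inv c) (at (snd c p)) a) \<F>"
proof -
  have Ck: "Ck_on 2 (F \<circ> chart_inv c) (snd c ` fst c)"
    using F c unfolding Ck_function_def charts_at_def by blast
  then have "continuous_on (snd c ` fst c) (F \<circ> chart_inv c)"
    unfolding numeral_2_eq_2 Ck_on.simps(2) by (blast intro: differentiable_imp_continuous_on)
  then show "((\<lambda>k. F (s k)) \<longlongrightarrow> F p) \<F>"
    by (intro chart_continuous_tendsto'[OF c s]) (simp add: o_def)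
  show "((\<lambda>k. frechet_derivative (F \<circ> chart_inv c) (at (snd c (s k))) a)
      \<longlongrightarrow> frechet_derivative (F \<circ> chart_inv c) (at (snd c p)) a) \<F>"
    by (rule chart_continuous_tendsto[OF c s Ck_on_2_continuous_derivative[OF Ck]])
qed

text \<open>Order 0 of the smoothness of the metric coefficients. It keeps the length of tangent
  vectors with fixed coordinates under control while the base point moves.\<close>

lemma metric_tendsto:
  assumes G: "riemannian_metric M A G" and c: "c \<in> charts_at A p" and s: "limitin M s p F"
  shows "((\<lambda>k. G (s k) (tangent_of_coords A c (s k) a) (tangent_of_coords A c (s k) b))
    \<longlongrightarrow> G p (tangent_of_coords A c p a) (tangent_of_coords A c p b)) F"
proof (rule chart_continuous_tendsto'[OF c s,
      where H = "\<lambda>q. G q (tangent_of_coords A c q a) (tangent_of_coords A c q b)"])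
  have "Ck_on 0 (\<lambda>y. let p = chart_inv c y in
      G p (tangent_of_coords A c p a) (tangent_of_coords A c p b)) (snd c ` fst c)"
    using G c unfolding riemannian_metric_def smooth_on_def charts_at_def by blast
  then show "continuous_on (snd c ` fst c) (\<lambda>y. G (chart_inv c y)
      (tangent_of_coords A c (chart_inv c y) a) (tangent_of_coords A c (chart_inv c y) b))"
    by (simp add: Let_def)
qed

end

section \<open>Smoothed penalty functions\<close>

text \<open>The last bound is what makes the multipliers of inactive constraints vanish as \<open>u \<rightarrow> 0\<close>.\<close>

definition smoothing_penalties ::
    "(real \<Rightarrow> real \<Rightarrow> real) \<Rightarrow> (real \<Rightarrow> real \<Rightarrow> real) \<Rightarrow> (real \<Rightarrow> real \<Rightarrow> real) \<Rightarrow>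
      (real \<Rightarrow> real \<Rightarrow> real) \<Rightarrow> bool"
  where "smoothing_penalties \<phi> \<phi>' \<psi> \<psi>' \<longleftrightarrow> (\<forall>u>0. \<forall>t.
     (\<phi> u has_real_derivative \<phi>' u t) (at t) \<and> (\<psi> u has_real_derivative \<psi>' u t) (at t) \<and>
     0 \<le> \<phi>' u t \<and> \<phi>' u t \<le> 1 \<and> \<bar>\<psi>' u t\<bar> \<le> 1 \<and> (t < 0 \<longrightarrow> \<phi>' u t \<le> u / - t))"

text \<open>The two weights are the logistic function and the hyperbolic tangent of
  \<open>t / u\<close>.\<close>

lemma smoothing_penalties_lse:
  "smoothing_penalties (\<lambda>u t. u * ln (1 + exp (t / u))) (\<lambda>u t. exp (t / u) / (1 + exp (t / u)))
     (\<lambda>u t. u * ln (exp (t / u) + exp (- t / u)))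
     (\<lambda>u t. (exp (t / u) - exp (- t / u)) / (exp (t / u) + exp (- t / u)))"
  unfolding smoothing_penalties_def
proof (intro allI impI conjI)
  fix u t :: real
  assume u: "0 < u"
  have pos: "1 + exp (t / u) > 0" "exp (t / u) + exp (- t / u) > 0"
    by (simp_all add: add_pos_pos)
  show "((\<lambda>t. u * ln (1 + exp (t / u))) has_real_derivative exp (t / u) / (1 + exp (t / u))) (at t)"
    using u pos by (auto intro!: derivative_eq_intros)
  show "((\<lambda>t. u * ln (exp (t / u) + exp (- t / u))) has_real_derivative
      (exp (t / u) - exp (- t / u)) / (exp (t / u) + exp (- t / u))) (at t)"
  proof -
    \<comment> \<open>The denominator scaled by \<open>u\<close>, known to be positive so that it
      can be cleared.\<close>
    have "u * exp (t / u) + u * exp (- (t / u)) > 0" using u by (simp add: add_pos_pos)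
    then show ?thesis using u pos(2) by (auto intro!: derivative_eq_intros simp: field_simps)
  qed
  show "0 \<le> exp (t / u) / (1 + exp (t / u))" "exp (t / u) / (1 + exp (t / u)) \<le> 1"
    using pos by (simp_all add: divide_simps)
  show "\<bar>(exp (t / u) - exp (- t / u)) / (exp (t / u) + exp (- t / u))\<bar> \<le> 1"
    using pos(2) by (simp add: abs_le_iff divide_simps)
  show "exp (t / u) / (1 + exp (t / u)) \<le> u / - t" if t: "t < 0"
  proof -
    have "exp (t / u) / (1 + exp (t / u)) \<le> exp (t / u)"
      using pos(1) by (simp add: divide_simps)
    also have "\<dots> = 1 / exp (- t / u)" by (simp add: exp_minus divide_simps)
    \<comment> \<open>From \<open>exp s \<ge> 1 + s > s\<close> at \<open>s = - t / u\<close>, which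
      is positive here. The exponential decay is weakened to the rate \<open>u / - t\<close> shared
      by both smoothings.\<close>
    also have "\<dots> \<le> 1 / (- t / u)"
      using exp_ge_add_one_self[of "- t / u"] t u by (intro frac_le) (auto simp: divide_neg_pos)
    finally show ?thesis using u by simp
  qed
qed

text \<open>Away from 0 a single branch holds on a ball of radius \<open>\<bar>t\<bar>\<close>. At 0
  the difference quotient \<open>(max 0 h)\<^sup>2 / h\<close> is just \<open>max 0 h\<close>, which
  tends to 0.\<close>

lemma has_real_derivative_square_pos_part:
  "((\<lambda>t. (max 0 t)\<^sup>2) has_real_derivative 2 * max 0 t) (at (t :: real))"
proof -
  consider "t < 0" | "t = 0" | "t > 0" by linarith
  then show ?thesis
  proof cases
    case 1
    have "((\<lambda>t. 0) has_real_derivative 2 * max 0 t) (at t)" using 1 by simp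
    then show ?thesis
      by (rule has_field_derivative_transform_within[where d = "- t"])
        (use 1 in \<open>auto simp: dist_real_def\<close>)
  next
    case 2
    have "((\<lambda>h :: real. max 0 h) \<longlongrightarrow> max 0 0) (at 0)" by (intro tendsto_intros)
    then have "((\<lambda>h :: real. (max 0 h)\<^sup>2 / h) \<longlongrightarrow> 0) (at 0)"
      by (rule Lim_transform_eventually[THEN tendsto_eq_rhs])
        (auto simp: eventually_at_filter max_def power2_eq_square)
    then show ?thesis using 2 by (simp add: DERIV_def)
  next
    case 3
    have "((\<lambda>t. t\<^sup>2) has_real_derivative 2 * max 0 t) (at t)"
      using 3 by (auto intro!: derivative_eq_intros)
    then show ?thesis
      by (rule has_field_derivative_transform_within[where d = t])
        (use 3 in \<open>auto simp: dist_real_def\<close>)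
  qed
qed

text \<open>A difference of functions differentiable everywhere, so the branch points 0 and
  \<open>u\<close> require no separate treatment.\<close>

lemma huber_penalty_eq_squares:
  "u > 0 \<Longrightarrow> huber_penalty t u = ((max 0 t)\<^sup>2 - (max 0 (t - u))\<^sup>2) / (2 * u)"
  by (auto simp: huber_penalty_def max_def divide_simps power2_eq_square algebra_simps)

text \<open>The first weight is \<open>t / u\<close> clamped to the interval from 0 to 1.\<close>

lemma smoothing_penalties_lqh:
  "smoothing_penalties (\<lambda>u t. huber_penalty t u) (\<lambda>u t. (max 0 t - max 0 (t - u)) / u)
     (\<lambda>u t. sqrt (t\<^sup>2 + u\<^sup>2)) (\<lambda>u t. t / sqrt (t\<^sup>2 + u\<^sup>2))"
  unfolding smoothing_penalties_def
proof (intro allI impI conjI)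
  fix u t :: real
  assume u: "0 < u"
  have pos: "t\<^sup>2 + u\<^sup>2 > 0" using u by (simp add: add_nonneg_pos)
  have "((\<lambda>t. (max 0 (t - u))\<^sup>2) has_real_derivative 2 * max 0 (t - u) * 1) (at t)"
    by (rule DERIV_chain2[OF has_real_derivative_square_pos_part]) (auto intro!: derivative_eq_intros)
  then have "((\<lambda>t. ((max 0 t)\<^sup>2 - (max 0 (t - u))\<^sup>2) / (2 * u)) has_real_derivative
      (2 * max 0 t - 2 * max 0 (t - u) * 1) / (2 * u)) (at t)"
    by (intro DERIV_cdivide DERIV_diff has_real_derivative_square_pos_part)
  then show "((\<lambda>t. huber_penalty t u) has_real_derivative (max 0 t - max 0 (t - u)) / u) (at t)"
    unfolding huber_penalty_eq_squares[OF u] by (rule DERIV_cong) (use u in \<open>simp add: divide_simps\<close>)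
  show "((\<lambda>t. sqrt (t\<^sup>2 + u\<^sup>2)) has_real_derivative t / sqrt (t\<^sup>2 + u\<^sup>2)) (at t)"
    using pos by (auto intro!: derivative_eq_intros simp: divide_simps)
  show "0 \<le> (max 0 t - max 0 (t - u)) / u" "(max 0 t - max 0 (t - u)) / u \<le> 1"
    using u by (auto simp: max_def divide_simps)
  have "\<bar>t\<bar> \<le> sqrt (t\<^sup>2 + u\<^sup>2)" using real_sqrt_sum_squares_ge1[of "\<bar>t\<bar>" u] by simp
  then show "\<bar>t / sqrt (t\<^sup>2 + u\<^sup>2)\<bar> \<le> 1" using pos by (simp add: divide_simps)
  \<comment> \<open>The left side is 0 for such \<open>t\<close>.\<close>
  show "(max 0 t - max 0 (t - u)) / u \<le> u / - t" if "t < 0"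
    using u that by (simp add: max_def divide_simps)
qed

text \<open>Lets the convergence proof treat both choices of \<open>Q\<close> at once;
  \<open>\<phi>\<close> smooths the positive part and \<open>\<psi>\<close> the absolute
  value.\<close>

lemma smoothed_penalty_function:
  assumes "Q \<in> {Q_lse n m f g h, Q_lqh n m f g h}"
  obtains \<phi> \<phi>' \<psi> \<psi>' where "smoothing_penalties \<phi> \<phi>' \<psi> \<psi>'"
    and "\<And>y \<rho> u. Q y \<rho> u = f y + \<rho> * (\<Sum>i\<in>ineq_idx n. \<phi> u (g i y)) + \<rho> * (\<Sum>j\<in>eq_idx n m. \<psi> u (h j y))"
  using assms that[OF smoothing_penalties_lse] that[OF smoothing_penalties_lqh]
  by (auto simp: Q_lse_def Q_lqh_def)

section \<open>Convergence of REPMS\<close>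

text \<open>No distance is below 0, so \<open>d_min P = 0\<close> disables the termination test and
  every iteration is constrained.\<close>

lemma repms_run_fixed_rho:
  assumes P: "valid_params P" "d_min P = 0" "u_min P = 0" "eps_min P = 0" "\<not> update_rho P"
    and run: "repms_run M A G n m g h Q P x \<epsilon> u \<rho>"
  shows "x (Suc k) \<in> topspace M"
    and "tnorm G (x (Suc k)) (grad A G (\<lambda>y. Q y (\<rho> k) (u k)) (x (Suc k))) \<le> \<epsilon> k"
    and "\<rho> k = rho_init P" and "0 < u k" and "\<epsilon> \<longlonglongrightarrow> 0" and "u \<longlonglongrightarrow> 0"
proof -
  have th: "0 < theta_eps P" "theta_eps P < 1" "0 < theta_u P" "theta_u P < 1"
    "eps_init P > 0" "u_init P > 0"
    using P(1) by (auto simp: valid_params_def)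
  have "\<not> repms_stop M A G P x \<epsilon> u k" for k by (simp add: repms_stop_def P)
  then have step: "x (Suc k) \<in> topspace M \<and>
      tnorm G (x (Suc k)) (grad A G (\<lambda>y. Q y (\<rho> k) (u k)) (x (Suc k))) \<le> \<epsilon> k \<and>
      \<epsilon> (Suc k) = max 0 (theta_eps P * \<epsilon> k) \<and> u (Suc k) = max 0 (theta_u P * u k) \<and>
      \<rho> (Suc k) = \<rho> k" for k
    using run unfolding repms_run_def P(3,4) by (simp add: P(5))
  have init: "\<epsilon> 0 = eps_init P" "u 0 = u_init P" "\<rho> 0 = rho_init P"
    using run by (auto simp: repms_run_def)
  show "x (Suc k) \<in> topspace M"
    and "tnorm G (x (Suc k)) (grad A G (\<lambda>y. Q y (\<rho> k) (u k)) (x (Suc k))) \<le> \<epsilon> k"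
    using step by blast+
  show "\<rho> k = rho_init P" by (induction k) (use step init in auto)
  \<comment> \<open>The terms stay nonnegative, so the maximum with 0 in the recursion has no effect
    and geometric decay remains; likewise for \<open>u\<close>.\<close>
  have eps: "\<epsilon> k = theta_eps P ^ k * eps_init P" for k
  proof (induction k)
    case (Suc k)
    then have "\<epsilon> k \<ge> 0" using th by simp
    then show ?case using step[of k] th Suc by simp
  qed (simp add: init)
  have u: "u k = theta_u P ^ k * u_init P" for k
  proof (induction k)
    case (Suc k)
    then have "u k \<ge> 0" using th by simp
    then show ?case using step[of k] th Suc by simp
  qed (simp add: init)
  show "0 < u k" using u th by simp
  show "\<epsilon> \<longlonglongrightarrow> 0" unfolding eps[abs_def]
    by (rule tendsto_mult_left_zero) (use th in \<open>simp add: LIMSEQ_realpow_zero\<close>)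
  show "u \<longlonglongrightarrow> 0" unfolding u[abs_def]
    by (rule tendsto_mult_left_zero) (use th in \<open>simp add: LIMSEQ_realpow_zero\<close>)
qed

text \<open>Bolzano-Weierstrass, one index at a time: refining the subsequence for a new index
  preserves the convergence obtained for the earlier ones.\<close>

lemma finite_family_convergent_subsequence:
  fixes a :: "nat \<Rightarrow> 'i \<Rightarrow> real"
  assumes "finite I" and "\<And>k i. i \<in> I \<Longrightarrow> \<bar>a k i\<bar> \<le> B"
  obtains s l where "strict_mono (s :: nat \<Rightarrow> nat)" "\<And>i. i \<in> I \<Longrightarrow> (\<lambda>k. a (s k) i) \<longlonglongrightarrow> l i"
proof -
  have "\<exists>s::nat \<Rightarrow> nat. strict_mono s \<and> (\<forall>i\<in>I. convergent (\<lambda>k. a (s k) i))"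
    using assms
  proof (induction I rule: finite_induct)
    case empty
    then show ?case using strict_mono_id by auto
  next
    case (insert j J)
    then obtain s where s: "strict_mono (s :: nat \<Rightarrow> nat)" "\<forall>i\<in>J. convergent (\<lambda>k. a (s k) i)"
      by auto
    have "bounded (range (\<lambda>k. a (s k) j))"
      using insert.prems by (auto simp: bounded_iff)
    then obtain L s' where s': "strict_mono (s' :: nat \<Rightarrow> nat)" "((\<lambda>k. a (s k) j) \<circ> s') \<longlonglongrightarrow> L"
      using bounded_imp_convergent_subsequence by blast
    have "convergent (\<lambda>k. a ((s \<circ> s') k) i)" if "i \<in> insert j J" for i
    proof (cases "i = j")
      case True
      then show ?thesis using s'(2) by (auto simp: o_def convergent_def)
    next
      case False
      then have "convergent (\<lambda>k. a (s k) i)" using s(2) that by blast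
      from convergent_subseq_convergent[OF this s'(1)] show ?thesis by (simp add: o_def)
    qed
    then show ?case using strict_mono_o[OF s(1) s'(1)] by blast
  qed
  then obtain s where s: "strict_mono (s :: nat \<Rightarrow> nat)" "\<forall>i\<in>I. convergent (\<lambda>k. a (s k) i)"
    by blast
  show thesis
    by (rule that[OF s(1), of "\<lambda>i. lim (\<lambda>k. a (s k) i)"])
      (use s(2) in \<open>simp add: convergent_LIMSEQ_iff\<close>)
qed

text \<open>Squeezed below \<open>u k / - t k\<close> once \<open>t k < 0\<close>; that quotient
  vanishes in the limit because its denominator tends to \<open>- l > 0\<close>.\<close>

lemma smoothing_penalty_weight_tendsto_0:
  assumes S: "smoothing_penalties \<phi> \<phi>' \<psi> \<psi>'" and pos: "\<And>k. 0 < u k" and u: "(u \<longlongrightarrow> 0) F"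
    and t: "(t \<longlongrightarrow> l) F" and l: "l < 0"
  shows "((\<lambda>k. \<phi>' (u k) (t k)) \<longlongrightarrow> 0) F"
proof (rule tendsto_sandwich[OF _ _ tendsto_const])
  show "\<forall>\<^sub>F k in F. 0 \<le> \<phi>' (u k) (t k)"
    using S pos by (simp add: smoothing_penalties_def)
  show "\<forall>\<^sub>F k in F. \<phi>' (u k) (t k) \<le> u k / - t k"
    by (rule eventually_mono[OF order_tendstoD(2)[OF t l]])
      (use S pos in \<open>auto simp: smoothing_penalties_def\<close>)
  have "((\<lambda>k. u k / - t k) \<longlongrightarrow> 0 / - l) F" by (intro tendsto_intros u t) (use l in simp)
  then show "((\<lambda>k. u k / - t k) \<longlongrightarrow> 0) F" by simp
qed

text \<open>Chain rule, with \<open>\<xi>\<close> in the role of a chart inverse. The result is the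
  derivative of a Lagrangian whose multipliers are the weights scaled by
  \<open>\<rho>\<close>.\<close>

lemma smoothed_penalty_has_derivative:
  fixes \<xi> :: "'e::real_normed_vector \<Rightarrow> 'a"
  assumes S: "smoothing_penalties \<phi> \<phi>' \<psi> \<psi>'" and u: "u > 0"
    and Q: "\<And>y. Q y = f y + \<rho> * (\<Sum>i\<in>I. \<phi> u (g i y)) + \<rho> * (\<Sum>j\<in>J. \<psi> u (h j y))"
    and \<xi>: "\<xi> y = p"
    and f: "(f \<circ> \<xi> has_derivative Df) (at y)"
    and g: "\<And>i. i \<in> I \<Longrightarrow> (g i \<circ> \<xi> has_derivative Dg i) (at y)"
    and h: "\<And>j. j \<in> J \<Longrightarrow> (h j \<circ> \<xi> has_derivative Dh j) (at y)"
  shows "(Q \<circ> \<xi> has_derivative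
    (\<lambda>a. Df a + (\<Sum>i\<in>I. \<rho> * \<phi>' u (g i p) * Dg i a) + (\<Sum>j\<in>J. \<rho> * \<psi>' u (h j p) * Dh j a)))
    (at y)"
proof -
  have chain: "((\<lambda>z. \<theta> (w (\<xi> z))) has_derivative (\<lambda>a. \<theta>' * D a)) (at y)"
    if "(\<theta> has_real_derivative \<theta>') (at (w p))" "(w \<circ> \<xi> has_derivative D) (at y)"
    for \<theta> :: "real \<Rightarrow> real" and \<theta>' w D
    using diff_chain_at[OF that(2), of \<theta> "(*) \<theta>'"] that(1) \<xi>
    by (simp add: has_field_derivative_def o_def)
  have "((\<lambda>z. f (\<xi> z) + \<rho> * (\<Sum>i\<in>I. \<phi> u (g i (\<xi> z))) + \<rho> * (\<Sum>j\<in>J. \<psi> u (h j (\<xi> z))))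
    has_derivative (\<lambda>a. Df a + \<rho> * (\<Sum>i\<in>I. \<phi>' u (g i p) * Dg i a)
      + \<rho> * (\<Sum>j\<in>J. \<psi>' u (h j p) * Dh j a))) (at y)"
    using S u f g h
    by (intro has_derivative_add has_derivative_mult_right has_derivative_sum chain)
      (auto simp: smoothing_penalties_def o_def)
  then show ?thesis by (simp add: Q[abs_def] o_def sum_distrib_left mult.assoc)
qed

theorem proposition4p2:
  fixes M :: "'a topology"
    and A :: "('a, 'e::real_normed_vector) chart set"
    and G :: "('a, 'e) metric_tensor"
    and n m :: nat
    and f :: "'a \<Rightarrow> real"
    and g h :: "nat \<Rightarrow> 'a \<Rightarrow> real"
    and Q :: "'a \<Rightarrow> real \<Rightarrow> real \<Rightarrow> real"
    and P :: repms_params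
    and x :: "nat \<Rightarrow> 'a"
    and \<epsilon> u \<rho> :: "nat \<Rightarrow> real"
    and r :: "nat \<Rightarrow> nat"
    and xbar :: 'a
  assumes "complete_riemannian_manifold M A G"
    and "Ck_function 2 A f"
    and "\<forall>i\<in>ineq_idx n. Ck_function 2 A (g i)"
    and "\<forall>j\<in>eq_idx n m. Ck_function 2 A (h j)"
    and "Q \<in> {Q_lse n m f g h, Q_lqh n m f g h}"
    and "valid_params P"
    and "d_min P = 0" and "u_min P = 0" and "eps_min P = 0" and "\<not> update_rho P"
    and "repms_run M A G n m g h Q P x \<epsilon> u \<rho>"
    and "strict_mono r" and "limitin M (x \<circ> r) xbar sequentially"
    and "feasible M n m g h xbar"
    and "LICQ A G n m g h xbar"
  shows "KKT M A G n m f g h xbar"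
proof -
  let ?I = "ineq_idx n" and ?J = "eq_idx n m"
  have mfd: "smooth_manifold M A" and met: "riemannian_metric M A G"
    using assms(1) unfolding complete_riemannian_manifold_def by blast+
  have xbar: "xbar \<in> topspace M" and gbar: "\<And>i. i \<in> ?I \<Longrightarrow> g i xbar \<le> 0"
    and hbar: "\<And>j. j \<in> ?J \<Longrightarrow> h j xbar = 0"
    using assms(14) unfolding feasible_def by blast+
  have "\<exists>c. c \<in> charts_at A xbar"
    using mfd xbar unfolding smooth_manifold_def charts_at_def by blast
  then obtain c where c: "c \<in> charts_at A xbar" ..
  have ip: "inner_product_on (tangent_space A p) (G p)" if "p \<in> topspace M" for p
    using met that unfolding riemannian_metric_def by blast
  note run = repms_run_fixed_rho[OF assms(6-11)]
  define \<rho>0 where "\<rho>0 = rho_init P"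
  have \<rho>0: "\<rho>0 > 0" using assms(6) by (simp add: \<rho>0_def valid_params_def)
  obtain \<phi> \<phi>' \<psi> \<psi>' where S: "smoothing_penalties \<phi> \<phi>' \<psi> \<psi>'"
    and Q: "\<And>y \<rho> u. Q y \<rho> u = f y + \<rho> * (\<Sum>i\<in>?I. \<phi> u (g i y)) + \<rho> * (\<Sum>j\<in>?J. \<psi> u (h j y))"
    using smoothed_penalty_function[OF assms(5)] by blast

  \<comment> \<open>\<open>x (r k)\<close> is the output of iteration \<open>r k - 1\<close>, but
    \<open>r 0\<close> may be 0, and no stopping criterion is known for the starting point. Starting
    from \<open>r (Suc k) \<ge> 1\<close> avoids this.\<close>
  define q where "q k = r (Suc k) - 1" for k
  have q: "Suc (q k) = r (Suc k)" for k
    using strict_mono_imp_increasing[OF assms(12), of "Suc k"] by (simp add: q_def)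
  have q_mono: "strict_mono q"
    using assms(12) q by (metis Suc_less_eq strict_mono_def)
  define z where "z k = x (Suc (q k))" for k
  define w where "w k = u (q k)" for k
  have w: "w \<longlonglongrightarrow> 0" "\<And>k. w k > 0"
    using LIMSEQ_subseq_LIMSEQ[OF run(6) q_mono] run(4) by (auto simp: w_def[abs_def] o_def)
  have eps: "(\<lambda>k. \<epsilon> (q k)) \<longlonglongrightarrow> 0"
    using LIMSEQ_subseq_LIMSEQ[OF run(5) q_mono] by (simp add: o_def)
  have z: "limitin M z xbar sequentially"
    using limitin_subsequence[of Suc M "x \<circ> r" xbar] assms(13)
    by (simp add: z_def[abs_def] q o_def strict_mono_def)

  define D where "D F p a = frechet_derivative (F \<circ> chart_inv c) (at (snd c p)) a"
    for F :: "'a \<Rightarrow> real" and p a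
  define lam where "lam k i = \<rho>0 * \<phi>' (w k) (g i (z k))" for k i
  define gam where "gam k j = \<rho>0 * \<psi>' (w k) (h j (z k))" for k j
  \<comment> \<open>Turns out to be the coordinate derivative of \<open>Q\<close> at
    \<open>z k\<close> whenever \<open>z k\<close> lies in the domain of \<open>c\<close>.\<close>
  define R where "R k a = D f (z k) a + (\<Sum>i\<in>?I. lam k i * D (g i) (z k) a)
    + (\<Sum>j\<in>?J. gam k j * D (h j) (z k) a)" for k a
  let ?T = "tangent_of_coords A c"

  have R_bound: "\<bar>R k a\<bar> \<le> \<epsilon> (q k) * sqrt (G (z k) (?T (z k) a) (?T (z k) a))"
    if zk: "z k \<in> fst c" for k a
  proof -
    have ck: "c \<in> charts_at A (z k)" using zk c by (simp add: charts_at_def)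
    have cA: "c \<in> A" using c by (simp add: charts_at_def)
    have der: "(F \<circ> chart_inv c has_derivative D F (z k)) (at (snd c (z k)))"
      if "Ck_function 2 A F" for F
      using C2_function_has_derivative[OF mfd that ck] by (simp add: D_def[abs_def])
    let ?Q = "\<lambda>y. Q y (\<rho> (q k)) (u (q k))"
    have ipk: "inner_product_on (tangent_space A (z k)) (G (z k))"
      using ip run(1) by (simp add: z_def)
    have "(?Q \<circ> chart_inv c has_derivative R k) (at (snd c (z k)))"
      unfolding R_def lam_def gam_def
    proof (rule smoothed_penalty_has_derivative[OF S w(2)])
      show "?Q y = f y + \<rho>0 * (\<Sum>i\<in>?I. \<phi> (w k) (g i y)) + \<rho>0 * (\<Sum>j\<in>?J. \<psi> (w k) (h j y))" for y
        by (simp add: Q run(3) \<rho>0_def w_def)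
    qed (use assms(2-4) der chart_inv_snd[OF mfd cA zk] in auto)
    \<comment> \<open>The second fact reads \<open>R k a\<close> as the pairing of the gradient of
      \<open>?Q\<close> with the tangent vector of coordinates \<open>a\<close>, so Cauchy-Schwarz
      applies.\<close>
    note gr = grad_works[where G = G, OF mfd ipk ck this]
    have T: "?T (z k) a \<in> tangent_space A (z k)"
      using tangent_space_eq_range[OF mfd ck] by blast
    have "\<bar>R k a\<bar> \<le> tnorm G (z k) (grad A G ?Q (z k)) * sqrt (G (z k) (?T (z k) a) (?T (z k) a))"
      using inner_product_on_Cauchy_Schwarz[OF ipk subspace_tangent_space[OF mfd ck] gr(1) T] gr(2)
      by (simp add: tnorm_def)
    also have "\<dots> \<le> \<epsilon> (q k) * sqrt (G (z k) (?T (z k) a) (?T (z k) a))"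
    proof (rule mult_right_mono)
      show "tnorm G (z k) (grad A G ?Q (z k)) \<le> \<epsilon> (q k)" using run(2) by (simp add: z_def)
      have "0 \<le> G (z k) (?T (z k) a) (?T (z k) a)"
        by (rule inner_product_on_nonneg[OF ipk T])
      then show "0 \<le> sqrt (G (z k) (?T (z k) a) (?T (z k) a))" by simp
    qed
    finally show ?thesis .
  qed
  \<comment> \<open>The metric factor of the bound converges while the tolerance tends to 0.\<close>
  have R_lim: "(\<lambda>k. R k a) \<longlonglongrightarrow> 0" for a
  proof (rule Lim_null_comparison)
    show "\<forall>\<^sub>F k in sequentially.
        norm (R k a) \<le> \<epsilon> (q k) * sqrt (G (z k) (?T (z k) a) (?T (z k) a))"
      using chart_tendsto(1)[OF mfd c z] by (rule eventually_mono) (simp add: R_bound)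
    have "(\<lambda>k. \<epsilon> (q k) * sqrt (G (z k) (?T (z k) a) (?T (z k) a)))
        \<longlonglongrightarrow> 0 * sqrt (G xbar (?T xbar a) (?T xbar a))"
      by (intro tendsto_mult tendsto_real_sqrt eps metric_tendsto[OF mfd met c z])
    then show "(\<lambda>k. \<epsilon> (q k) * sqrt (G (z k) (?T (z k) a) (?T (z k) a))) \<longlonglongrightarrow> 0" by simp
  qed

  \<comment> \<open>\<open>?I\<close> and \<open>?J\<close> are disjoint, so both multiplier
    families merge into one and a single subsequence serves them all.\<close>
  define mult where "mult k i = (if i \<in> ?I then lam k i else gam k i)" for k i
  have weights: "0 \<le> \<phi>' (w k) t" "\<phi>' (w k) t \<le> 1" "\<bar>\<psi>' (w k) t\<bar> \<le> 1" for k t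
    using S w(2) unfolding smoothing_penalties_def by blast+
  have "\<bar>mult k i\<bar> \<le> \<rho>0" for k i
    using weights \<rho>0 by (auto simp: mult_def lam_def gam_def abs_mult mult_le_cancel_left1)
  then obtain s l where s: "strict_mono (s :: nat \<Rightarrow> nat)"
    and l: "\<And>i. i \<in> ?I \<union> ?J \<Longrightarrow> (\<lambda>k. mult (s k) i) \<longlonglongrightarrow> l i"
    using finite_family_convergent_subsequence[of "?I \<union> ?J" mult \<rho>0] by blast
  have lam_lim: "(\<lambda>k. lam (s k) i) \<longlonglongrightarrow> l i" if "i \<in> ?I" for i
    using l[of i] that by (simp add: mult_def)
  have gam_lim: "(\<lambda>k. gam (s k) j) \<longlonglongrightarrow> l j" if "j \<in> ?J" for j
    using l[of j] that by (simp add: mult_def)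
  have zs: "limitin M (\<lambda>k. z (s k)) xbar sequentially"
    using limitin_subsequence[OF s z] by (simp add: o_def)

  have stationary: "D f xbar a + (\<Sum>i\<in>?I. l i * D (g i) xbar a) + (\<Sum>j\<in>?J. l j * D (h j) xbar a) = 0"
    (is "?L = 0") for a
  proof -
    have D_lim: "(\<lambda>k. D F (z (s k)) a) \<longlonglongrightarrow> D F xbar a" if "Ck_function 2 A F" for F
      unfolding D_def by (rule C2_function_tendsto(2)[OF mfd that c zs])
    have "(\<lambda>k. R (s k) a) \<longlonglongrightarrow> ?L"
      unfolding R_def using assms(2-4) by (intro tendsto_intros D_lim lam_lim gam_lim) auto
    moreover have "(\<lambda>k. R (s k) a) \<longlonglongrightarrow> 0"
      using LIMSEQ_subseq_LIMSEQ[OF R_lim s] by (simp add: o_def)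
    ultimately show ?thesis by (rule LIMSEQ_unique)
  qed
  have l_nonneg: "l i \<ge> 0" if "i \<in> ?I" for i
    by (rule LIMSEQ_le_const[OF lam_lim[OF that]]) (use weights \<rho>0 in \<open>auto simp: lam_def\<close>)
  have compl: "l i * g i xbar = 0" if i: "i \<in> ?I" for i
  proof (cases "g i xbar = 0")
    case False
    then have neg: "g i xbar < 0" using gbar[OF i] by simp
    have C2: "Ck_function 2 A (g i)" using assms(3) i by blast
    \<comment> \<open>The weight of an inactive constraint vanishes along all of \<open>z\<close>,
      so its limit \<open>l i\<close> along the subsequence is 0.\<close>
    have "(\<lambda>k. \<phi>' (w k) (g i (z k))) \<longlonglongrightarrow> 0"
      by (rule smoothing_penalty_weight_tendsto_0[OF S w(2) w(1) _ neg])
        (rule C2_function_tendsto(1)[OF mfd C2 c z])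
    then have "(\<lambda>k. lam k i) \<longlonglongrightarrow> 0" unfolding lam_def by (rule tendsto_mult_right_zero)
    then have "(\<lambda>k. lam (s k) i) \<longlonglongrightarrow> 0"
      using LIMSEQ_subseq_LIMSEQ[OF _ s] by (fastforce simp: o_def)
    then show ?thesis using LIMSEQ_unique[OF lam_lim[OF i]] by simp
  qed simp

  let ?V = "tangent_space A xbar"
  note ipx = ip[OF xbar] and V = subspace_tangent_space[OF mfd c]
  have gr: "grad A G F xbar \<in> ?V" "G xbar (grad A G F xbar) (?T xbar a) = D F xbar a"
    if "Ck_function 2 A F" for F a
    using grad_works[where G = G, OF mfd ipx c C2_function_has_derivative[OF mfd that c]]
    unfolding D_def by blast+
  define sg where "sg = (\<Sum>i\<in>?I. l i *\<^sub>R grad A G (g i) xbar)"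
  define sh where "sh = (\<Sum>j\<in>?J. l j *\<^sub>R grad A G (h j) xbar)"
  \<comment> \<open>The gradient of the Lagrangian at the limit point, which has to be shown to
    vanish.\<close>
  define W where "W = grad A G f xbar + sg + sh"
  have sgV: "sg \<in> ?V" and shV: "sh \<in> ?V"
    unfolding sg_def sh_def using gr(1) assms(3,4) by (auto intro!: subspace_sum[OF V] subspace_scale[OF V])
  have fV: "grad A G f xbar \<in> ?V" by (rule gr(1)[OF assms(2)])
  have fsgV: "grad A G f xbar + sg \<in> ?V" by (rule subspace_add[OF V fV sgV])
  have WV: "W \<in> ?V" unfolding W_def by (rule subspace_add[OF V fsgV shV])
  \<comment> \<open>Stationarity holds for every coordinate vector. Taking the coordinates of
    \<open>W\<close> itself turns it into \<open>G xbar W W = 0\<close>, and positive definiteness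
    gives \<open>W = 0\<close>.\<close>
  obtain a where a: "W = ?T xbar a" using WV tangent_space_eq_range[OF mfd c] by blast
  have TV: "?T xbar a \<in> ?V" using WV a by simp
  have "G xbar sg (?T xbar a) = (\<Sum>i\<in>?I. l i * D (g i) xbar a)"
    unfolding sg_def using inner_product_on_sum[OF ipx V TV, of ?I "\<lambda>i. grad A G (g i) xbar"] gr assms(3)
    by simp
  moreover have "G xbar sh (?T xbar a) = (\<Sum>j\<in>?J. l j * D (h j) xbar a)"
    unfolding sh_def using inner_product_on_sum[OF ipx V TV, of ?J "\<lambda>j. grad A G (h j) xbar"] gr assms(4)
    by simp
  ultimately have "G xbar W (?T xbar a) = 0"
    unfolding W_def inner_product_on_add[OF ipx fsgV shV TV] inner_product_on_add[OF ipx fV sgV TV]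
    using gr(2)[OF assms(2)] stationary by simp
  then have "W = 0" using inner_product_on_pos[OF ipx WV] a by force
  \<comment> \<open>The merged limit \<open>l\<close> serves as witness for both multiplier
    vectors.\<close>
  then show ?thesis
    unfolding KKT_def using xbar gbar hbar l_nonneg compl
    by (intro conjI exI[of _ l]) (auto simp: W_def sg_def sh_def)
qed

end
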